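(* (1) In regular spaces, every selectively $k$-star-ccc space has the DCCC, for each positive integer $k$. In fact, for a regular space $X$ the following properties are equivalent: (a) $X$ has the DCCC; (b) $X$ is weakly SL; (c) $X$ is $2$-SL; (d) $X$ is selectively $3$-star-ccc; and all the properties in between (that is, any property implied by one of (a)–(d) and implying one of (a)–(d)) are equivalent to these as well. (2) For a normal space $X$ the following properties are equivalent: (a) $X$ has the DCCC; (b) $X$ is weakly SSL; (c) $X$ is $2$-SSL; (d) $X$ is selectively $3$-star-ccc; and all the properties in between (in the same sense) are equivalent to these as well.
   Context: For an open cover $\mathcal{U}$ of a topological space $X$ and $A\subset X$, put $\operatorname{st}^1(A,\mathcal{U})=\bigcup\{U\in\mathcal{U}:U\cap A\neq\emptyset\}$ and inductively $\operatorname{st}^{n+1}(A,\mathcal{U})=\bigcup\{U\in\mathcal{U}:U\cap \operatorname{st}^n(A,\mathcal{U})\neq\emptyset\}$; write $\operatorname{st}=\operatorname{st}^1$. A space $X$ has the discrete countable chain condition (DCCC) if there does not exist an uncountable discrete family of open subsets of $X$ (a family is discrete if every point of $X$ has a neighbourhood meeting at most one member of the family). For a positive integer $k$: $X$ is $k$-SL ($k$-star-Lindelöf) if for every open cover $\mathcal{U}$ of $X$ there is a countable $\mathcal{U}'\subset\mathcal{U}$ with $\operatorname{st}^k(\bigcup\mathcal{U}',\mathcal{U})=X$. $X$ is $k$-SSL (strongly $k$-star-Lindelöf) if for every open cover $\mathcal{U}$ of $X$ there is a countable $A\subset X$ with $\operatorname{st}^k(A,\mathcal{U})=X$. $X$ is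 weakly SL if for every open cover $\mathcal{U}$ of $X$ there is a countable $\mathcal{U}'\subset\mathcal{U}$ with $\overline{\operatorname{st}(\bigcup\mathcal{U}',\mathcal{U})}=X$. $X$ is weakly SSL if for every open cover $\mathcal{U}$ of $X$ there is a countable $A\subset X$ with $\overline{\operatorname{st}(A,\mathcal{U})}=X$. For a positive integer $k$, $X$ is selectively $k$-star-ccc if for every open cover $\mathcal{U}$ of $X$ and every sequence $(\mathcal{A}_n:n\in\omega)$ of maximal pairwise disjoint open families of $X$, there is a sequence $(A_n:n\in\omega)$ with $A_n\in\mathcal{A}_n$ for all $n$ such that $\operatorname{st}^k(\bigcup_{n\in\omega}A_n,\mathcal{U})=X$. *)

theory Defs
  imports "HOL-Analysis.Analysis"
begin

text \<open>
  Spaces are abstract topologies \<^typ>\<open>'a topology\<close> with underlying set \<^term>\<open>topspace X\<close>.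
  Families of sets are sets of sets. ``Regular'' is the library's \<^const>\<open>regular_space\<close>, which
  does not include $T_1$. ``Normal'' is the usual $T_1$ notion (so that normal spaces are regular),
  whereas the library's \<^const>\<open>normal_space\<close> is only the separation of disjoint closed sets.
\<close>

definition T1_normal_space :: "'a topology \<Rightarrow> bool" where
  "T1_normal_space X \<longleftrightarrow> t1_space X \<and> normal_space X"

definition open_cover :: "'a topology \<Rightarrow> 'a set set \<Rightarrow> bool" where
  "open_cover X \<U> \<longleftrightarrow> (\<forall>U\<in>\<U>. openin X U) \<and> \<Union>\<U> = topspace X"

definition st :: "'a set \<Rightarrow> 'a set set \<Rightarrow> 'a set" where
  "st A \<U> = \<Union>{U \<in> \<U>. U \<inter> A \<noteq> {}}"

text \<open>The value at 0 is only a starting point for the recursion: \<open>st_iter 1 A \<U> = st A \<U>\<close>.\<close>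

primrec st_iter :: "nat \<Rightarrow> 'a set \<Rightarrow> 'a set set \<Rightarrow> 'a set" where
  "st_iter 0 A \<U> = A"
| "st_iter (Suc n) A \<U> = st (st_iter n A \<U>) \<U>"

definition discrete_family :: "'a topology \<Rightarrow> 'a set set \<Rightarrow> bool" where
  "discrete_family X \<F> \<longleftrightarrow>
     (\<forall>x\<in>topspace X. \<exists>N. openin X N \<and> x \<in> N \<and>
        (\<forall>F\<in>\<F>. \<forall>G\<in>\<F>. F \<inter> N \<noteq> {} \<longrightarrow> G \<inter> N \<noteq> {} \<longrightarrow> F = G))"

definition DCCC :: "'a topology \<Rightarrow> bool" where
  "DCCC X \<longleftrightarrow>
     \<not> (\<exists>\<F>. (\<forall>U\<in>\<F>. openin X U) \<and> discrete_family X \<F> \<and> uncountable \<F>)"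

definition star_Lindelof :: "nat \<Rightarrow> 'a topology \<Rightarrow> bool" where
  "star_Lindelof k X \<longleftrightarrow>
     (\<forall>\<U>. open_cover X \<U> \<longrightarrow>
        (\<exists>\<V>. \<V> \<subseteq> \<U> \<and> countable \<V> \<and> st_iter k (\<Union>\<V>) \<U> = topspace X))"

definition strongly_star_Lindelof :: "nat \<Rightarrow> 'a topology \<Rightarrow> bool" where
  "strongly_star_Lindelof k X \<longleftrightarrow>
     (\<forall>\<U>. open_cover X \<U> \<longrightarrow>
        (\<exists>A. A \<subseteq> topspace X \<and> countable A \<and> st_iter k A \<U> = topspace X))"

definition weakly_star_Lindelof :: "'a topology \<Rightarrow> bool" where
  "weakly_star_Lindelof X \<longleftrightarrow>
     (\<forall>\<U>. open_cover X \<U> \<longrightarrow>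
        (\<exists>\<V>. \<V> \<subseteq> \<U> \<and> countable \<V> \<and> X closure_of (st (\<Union>\<V>) \<U>) = topspace X))"

definition weakly_strongly_star_Lindelof :: "'a topology \<Rightarrow> bool" where
  "weakly_strongly_star_Lindelof X \<longleftrightarrow>
     (\<forall>\<U>. open_cover X \<U> \<longrightarrow>
        (\<exists>A. A \<subseteq> topspace X \<and> countable A \<and> X closure_of (st A \<U>) = topspace X))"

definition disjoint_open_family :: "'a topology \<Rightarrow> 'a set set \<Rightarrow> bool" where
  "disjoint_open_family X \<A> \<longleftrightarrow> (\<forall>A\<in>\<A>. openin X A) \<and> pairwise disjnt \<A>"

text \<open>
  The empty set is allowed as a member, hence belongs to every maximal family. On a nonempty space
  this does not affect which selections below can succeed; on the empty space it ensures that there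
  is something to select.
\<close>

definition maximal_disjoint_open_family :: "'a topology \<Rightarrow> 'a set set \<Rightarrow> bool" where
  "maximal_disjoint_open_family X \<A> \<longleftrightarrow>
     disjoint_open_family X \<A> \<and>
     (\<forall>\<B>. disjoint_open_family X \<B> \<longrightarrow> \<A> \<subseteq> \<B> \<longrightarrow> \<B> = \<A>)"

definition selectively_star_ccc :: "nat \<Rightarrow> 'a topology \<Rightarrow> bool" where
  "selectively_star_ccc k X \<longleftrightarrow>
     (\<forall>\<U> \<A>. open_cover X \<U> \<longrightarrow> (\<forall>n::nat. maximal_disjoint_open_family X (\<A> n)) \<longrightarrow>
        (\<exists>A. (\<forall>n. A n \<in> \<A> n) \<and> st_iter k (\<Union>n. A n) \<U> = topspace X))"

text \<open>
  Implications between topological properties are relative to a class \<open>C\<close> of spaces.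
\<close>

definition implies_on ::
  "('a topology \<Rightarrow> bool) \<Rightarrow> ('a topology \<Rightarrow> bool) \<Rightarrow> ('a topology \<Rightarrow> bool) \<Rightarrow> bool" where
  "implies_on C P Q \<longleftrightarrow> (\<forall>X. C X \<longrightarrow> P X \<longrightarrow> Q X)"

definition equivalent_on ::
  "('a topology \<Rightarrow> bool) \<Rightarrow> ('a topology \<Rightarrow> bool) set \<Rightarrow> bool" where
  "equivalent_on C \<P> \<longleftrightarrow> (\<forall>P\<in>\<P>. \<forall>Q\<in>\<P>. implies_on C P Q)"

definition in_between ::
  "('a topology \<Rightarrow> bool) \<Rightarrow> ('a topology \<Rightarrow> bool) set \<Rightarrow> ('a topology \<Rightarrow> bool) \<Rightarrow> bool" where
  "in_between C \<P> R \<longleftrightarrow> (\<exists>P\<in>\<P>. implies_on C P R) \<and> (\<exists>Q\<in>\<P>. implies_on C R Q)"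

end

theory Submission
  imports Defs
begin

text \<open>
  The DCCC is exploited by maximality: for an open cover \<open>\<U>\<close>, a family of open sets such that
  every member of \<open>\<U>\<close> meets at most one of them is discrete, hence countable under the DCCC. If the
  family is maximal and each of its sets lies in a chosen member of \<open>\<U>\<close>, then the star of the union
  of the chosen members is dense. In a normal space one takes points together with pairwise
  disjoint neighbourhoods instead; the points form a closed set, and shrinking inside the union
  of the neighbourhoods by normality makes them a discrete family. Conversely, in a regular space
  an uncountable discrete family \<open>\<F>\<close> yields a cover that needs more than \<open>k\<close> stars to travel from the
  outside of any \<open>F \<in> \<F>\<close> to its core, whereas a countable selection misses some \<open>F\<close>.
\<close>

section \<open>Maximal families and iterated stars\<close>

text \<open>Zorn's lemma, in the form used for the maximal families extracted under the DCCC.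
  \<open>R\<close> need not be symmetric, so a candidate is tested in both directions.\<close>

lemma maximal_pairwise_subset:
  obtains M where "M \<subseteq> B" "pairwise R M"
    "\<And>b. b \<in> B \<Longrightarrow> (\<And>m. m \<in> M \<Longrightarrow> R b m \<and> R m b) \<Longrightarrow> b \<in> M"
proof -
  let ?A = "{M. M \<subseteq> B \<and> pairwise R M}"
  have "\<exists>M\<in>?A. \<forall>N\<in>?A. M \<subseteq> N \<longrightarrow> N = M"
  proof (rule subset_Zorn')
    fix C assume C: "subset.chain ?A C"
    show "\<Union>C \<in> ?A"
      using C by (auto simp: subset_chain_def chain_subset_def intro!: pairwise_chain_Union)
  qed
  then obtain M where M: "M \<subseteq> B" "pairwise R M"
    and max: "\<And>N. N \<subseteq> B \<Longrightarrow> pairwise R N \<Longrightarrow> M \<subseteq> N \<Longrightarrow> N = M"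
    by auto
  show thesis
  proof (rule that[OF M])
    fix b assume "b \<in> B" "\<And>m. m \<in> M \<Longrightarrow> R b m \<and> R m b"
    then show "b \<in> M"
      using max[of "insert b M"] M by (auto simp: pairwise_insert)
  qed
qed

lemma st_mono: "A \<subseteq> B \<Longrightarrow> st A \<U> \<subseteq> st B \<U>"
  unfolding st_def by blast

lemma st_iter_mono: "A \<subseteq> B \<Longrightarrow> st_iter k A \<U> \<subseteq> st_iter k B \<U>"
  by (induction k) (simp_all add: st_mono)

lemma st_subset_topspace: "open_cover X \<U> \<Longrightarrow> st A \<U> \<subseteq> topspace X"
  unfolding st_def open_cover_def by blast

text \<open>A cover member around a point is a neighbourhood of it and so meets a dense set. Density
  of a star is thus traded for one more star.\<close>

lemma st_dense:
  assumes "open_cover X \<U>" and "X closure_of S = topspace X"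
  shows "st S \<U> = topspace X"
proof
  show "topspace X \<subseteq> st S \<U>"
  proof
    fix x assume x: "x \<in> topspace X"
    then obtain U where U: "U \<in> \<U>" "x \<in> U" "openin X U"
      using assms(1) unfolding open_cover_def by blast
    have "x \<in> X closure_of S" using x assms(2) by simp
    then have "U \<inter> S \<noteq> {}"
      using U unfolding in_closure_of by blast
    then show "x \<in> st S \<U>" using U unfolding st_def by blast
  qed
qed (rule st_subset_topspace[OF assms(1)])

lemma dense_if_meets_open:
  assumes "\<And>Q x. openin X Q \<Longrightarrow> x \<in> Q \<Longrightarrow> Q \<inter> S = {} \<Longrightarrow> False"
  shows "X closure_of S = topspace X"
  unfolding dense_intersects_open
proof (intro allI impI)
  fix T assume "openin X T \<and> T \<noteq> {}"
  then obtain x where "openin X T" "x \<in> T" by auto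
  then show "S \<inter> T \<noteq> {}" using assms[of T x] by (auto simp: Int_commute)
qed

text \<open>Otherwise \<open>V\<close> could be added to the family. The implication stands under
  the quantifier so that a member can be selected even for empty \<open>V\<close>.\<close>

lemma maximal_disjoint_open_family_meets:
  assumes "maximal_disjoint_open_family X \<A>" and "openin X V"
  shows "\<exists>A\<in>\<A>. V \<noteq> {} \<longrightarrow> A \<inter> V \<noteq> {}"
proof (rule ccontr)
  assume "\<not> ?thesis"
  then have *: "\<And>A. A \<in> \<A> \<Longrightarrow> V \<noteq> {} \<and> A \<inter> V = {}" by blast
  then have "disjoint_open_family X (insert V \<A>)"
    using assms unfolding maximal_disjoint_open_family_def disjoint_open_family_def
    by (auto simp: pairwise_insert disjnt_def)
  then have "insert V \<A> = \<A>"
    using assms(1) unfolding maximal_disjoint_open_family_def by blast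
  then show False using * by blast
qed

section \<open>Implications valid in every space\<close>

lemma weakly_star_Lindelof_imp_star_Lindelof_2:
  assumes "weakly_star_Lindelof X"
  shows "star_Lindelof 2 X"
  unfolding star_Lindelof_def
proof (intro allI impI)
  fix \<U> assume \<U>: "open_cover X \<U>"
  then obtain \<V> where "\<V> \<subseteq> \<U>" "countable \<V>" "X closure_of (st (\<Union>\<V>) \<U>) = topspace X"
    using assms unfolding weakly_star_Lindelof_def by blast
  with st_dense[OF \<U>] show "\<exists>\<V>\<subseteq>\<U>. countable \<V> \<and> st_iter 2 (\<Union>\<V>) \<U> = topspace X"
    unfolding numeral_2_eq_2 st_iter.simps by blast
qed

lemma weakly_strongly_star_Lindelof_imp_strongly_star_Lindelof_2:
  assumes "weakly_strongly_star_Lindelof X"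
  shows "strongly_star_Lindelof 2 X"
  unfolding strongly_star_Lindelof_def
proof (intro allI impI)
  fix \<U> assume \<U>: "open_cover X \<U>"
  then obtain A where "A \<subseteq> topspace X" "countable A" "X closure_of (st A \<U>) = topspace X"
    using assms unfolding weakly_strongly_star_Lindelof_def by blast
  with st_dense[OF \<U>] show "\<exists>A\<subseteq>topspace X. countable A \<and> st_iter 2 A \<U> = topspace X"
    unfolding numeral_2_eq_2 st_iter.simps by blast
qed

text \<open>Replace each point of the countable set by one cover member containing it; stars are
  monotone.\<close>

lemma strongly_star_Lindelof_imp_star_Lindelof:
  assumes "strongly_star_Lindelof (Suc k) X"
  shows "star_Lindelof (Suc k) X"
  unfolding star_Lindelof_def
proof (intro allI impI)
  fix \<U> assume \<U>: "open_cover X \<U>"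
  then obtain A where A: "A \<subseteq> topspace X" "countable A" "st_iter (Suc k) A \<U> = topspace X"
    using assms unfolding strongly_star_Lindelof_def by blast
  have "\<forall>a\<in>A. \<exists>U\<in>\<U>. a \<in> U"
    using A \<U> unfolding open_cover_def by blast
  then obtain u where u: "\<And>a. a \<in> A \<Longrightarrow> u a \<in> \<U> \<and> a \<in> u a" by metis
  then have "A \<subseteq> \<Union>(u ` A)" by blast
  then have "topspace X \<subseteq> st_iter (Suc k) (\<Union>(u ` A)) \<U>"
    using A(3) st_iter_mono by metis
  then have "st_iter (Suc k) (\<Union>(u ` A)) \<U> = topspace X"
    using st_subset_topspace[OF \<U>] by auto
  moreover have "u ` A \<subseteq> \<U>" "countable (u ` A)" using u A by auto
  ultimately show "\<exists>\<V>\<subseteq>\<U>. countable \<V> \<and> st_iter (Suc k) (\<Union>\<V>) \<U> = topspace X" by blast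
qed

text \<open>Of the three stars, the first recovers \<open>\<Union>\<V>\<close> from the selected
  sets, the second is dense, and the third covers the space.\<close>

lemma weakly_star_Lindelof_imp_selectively_star_ccc_3:
  assumes "weakly_star_Lindelof X"
  shows "selectively_star_ccc 3 X"
  unfolding selectively_star_ccc_def
proof (intro allI impI)
  fix \<U> and \<A> :: "nat \<Rightarrow> 'a set set"
  assume \<U>: "open_cover X \<U>" and \<A>: "\<forall>n. maximal_disjoint_open_family X (\<A> n)"
  obtain \<V> where \<V>: "\<V> \<subseteq> \<U>" "countable \<V>" "X closure_of (st (\<Union>\<V>) \<U>) = topspace X"
    using assms \<U> unfolding weakly_star_Lindelof_def by blast
  \<comment> \<open>The empty set is added because \<open>from_nat_into\<close> enumerates a
    countable set only if it is nonempty, and \<V> may be empty.\<close>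
  have countable: "countable (insert {} \<V>)" using \<V>(2) by simp
  have "\<And>V. V \<in> insert {} \<V> \<Longrightarrow> openin X V"
    using \<V>(1) \<U> unfolding open_cover_def by auto
  moreover define v where "v = from_nat_into (insert {} \<V>)"
  ultimately have "openin X (v n)" for n
    using from_nat_into[of "insert {} \<V>" n] by blast
  then have "\<forall>n. \<exists>A\<in>\<A> n. v n \<noteq> {} \<longrightarrow> A \<inter> v n \<noteq> {}"
    using maximal_disjoint_open_family_meets \<A> by blast
  then obtain A where A: "\<And>n. A n \<in> \<A> n" "\<And>n. v n \<noteq> {} \<Longrightarrow> A n \<inter> v n \<noteq> {}"
    by metis
  \<comment> \<open>A nonempty \<open>V\<close> in \<V> is itself a member of \<U> that meets the
    set selected for it, so all of \<open>V\<close> lies in the star.\<close>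
  have "\<Union>\<V> \<subseteq> st (\<Union>n. A n) \<U>"
  proof
    fix x assume "x \<in> \<Union>\<V>"
    then obtain V where V: "V \<in> \<V>" "x \<in> V" by blast
    then obtain n where "v n = V"
      using from_nat_into_surj[OF countable, of V] unfolding v_def by blast
    then have "A n \<inter> V \<noteq> {}" using A(2)[of n] V by blast
    then show "x \<in> st (\<Union>n. A n) \<U>" using V \<V>(1) unfolding st_def by blast
  qed
  then have "st (st (\<Union>\<V>) \<U>) \<U> \<subseteq> st_iter 3 (\<Union>n. A n) \<U>"
    by (simp add: numeral_3_eq_3 st_mono)
  then have "st_iter 3 (\<Union>n. A n) \<U> = topspace X"
    using st_dense[OF \<U> \<V>(3)] st_subset_topspace[OF \<U>]
    by (simp add: numeral_3_eq_3 subset_antisym)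
  then show "\<exists>A. (\<forall>n. A n \<in> \<A> n) \<and> st_iter 3 (\<Union>n. A n) \<U> = topspace X"
    using A(1) by blast
qed

lemma DCCC_imp_weakly_star_Lindelof:
  assumes "DCCC X"
  shows "weakly_star_Lindelof X"
  unfolding weakly_star_Lindelof_def
proof (intro allI impI)
  fix \<U> assume \<U>: "open_cover X \<U>"
  \<comment> \<open>Refining \<U> lets every chosen set be enlarged to a member of \<U>.
    Nonemptiness makes the relation below irreflexive on \<open>B\<close>, so that adding a
    compatible set is a contradiction.\<close>
  define B where "B = {W. openin X W \<and> W \<noteq> {} \<and> (\<exists>U\<in>\<U>. W \<subseteq> U)}"
  obtain \<W> where \<W>: "\<W> \<subseteq> B" "pairwise (\<lambda>W W'. \<forall>U\<in>\<U>. U \<inter> W = {} \<or> U \<inter> W' = {}) \<W>"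
    and max: "\<And>W. W \<in> B \<Longrightarrow> (\<And>W'. W' \<in> \<W> \<Longrightarrow>
      (\<forall>U\<in>\<U>. U \<inter> W = {} \<or> U \<inter> W' = {}) \<and> (\<forall>U\<in>\<U>. U \<inter> W' = {} \<or> U \<inter> W = {})) \<Longrightarrow> W \<in> \<W>"
    using maximal_pairwise_subset[of B "\<lambda>W W'. \<forall>U\<in>\<U>. U \<inter> W = {} \<or> U \<inter> W' = {}"] by blast
  have "discrete_family X \<W>"
    unfolding discrete_family_def
  proof
    fix x assume "x \<in> topspace X"
    then obtain U where "U \<in> \<U>" "x \<in> U" "openin X U"
      using \<U> unfolding open_cover_def by blast
    then show "\<exists>N. openin X N \<and> x \<in> N \<and>
        (\<forall>F\<in>\<W>. \<forall>G\<in>\<W>. F \<inter> N \<noteq> {} \<longrightarrow> G \<inter> N \<noteq> {} \<longrightarrow> F = G)"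
      using \<W>(2) unfolding pairwise_def by (intro exI[of _ U]) blast
  qed
  then have "countable \<W>"
    using assms \<W>(1) unfolding DCCC_def B_def by blast
  have "\<forall>W\<in>\<W>. \<exists>U\<in>\<U>. W \<subseteq> U" using \<W>(1) unfolding B_def by blast
  then obtain u where u: "\<And>W. W \<in> \<W> \<Longrightarrow> u W \<in> \<U> \<and> W \<subseteq> u W" by metis
  define \<V> where "\<V> = u ` \<W>"
  have "X closure_of (st (\<Union>\<V>) \<U>) = topspace X"
  proof (rule dense_if_meets_open)
    fix Q x assume Q: "openin X Q" "x \<in> Q" "Q \<inter> st (\<Union>\<V>) \<U> = {}"
    then obtain U where U: "U \<in> \<U>" "x \<in> U" "openin X U"
      using \<U> openin_subset unfolding open_cover_def by blast
    define W where "W = Q \<inter> U"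
    have "W \<in> B" using Q U unfolding B_def W_def by blast
    \<comment> \<open>A cover member meeting both \<open>W\<close> and \<open>W'\<close> would meet
      \<open>u W'\<close>, hence lie in the star, although it meets \<open>Q\<close>.\<close>
    moreover have far: "T \<inter> W = {} \<or> T \<inter> W' = {}" if "W' \<in> \<W>" "T \<in> \<U>" for W' T
      using u[OF that(1)] that Q(3) unfolding W_def \<V>_def st_def by blast
    ultimately have "W \<in> \<W>" using max by blast
    then show False using far[of W U] U Q(2) unfolding W_def by blast
  qed
  moreover have "\<V> \<subseteq> \<U>" "countable \<V>"
    using u \<open>countable \<W>\<close> unfolding \<V>_def by auto
  ultimately show "\<exists>\<V>\<subseteq>\<U>. countable \<V> \<and> X closure_of (st (\<Union>\<V>) \<U>) = topspace X" by blast
qed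

section \<open>Normal spaces: countable sets with dense star\<close>

text \<open>Each cover member contains at most one point of \<open>D\<close>; deleting it, which
  leaves an open set by $T_1$, gives neighbourhoods that miss \<open>D\<close>.\<close>

lemma closedin_if_cover_separates:
  assumes "t1_space X" "open_cover X \<U>" "D \<subseteq> topspace X"
    and sep: "\<And>U x y. U \<in> \<U> \<Longrightarrow> x \<in> D \<Longrightarrow> y \<in> D \<Longrightarrow> x \<in> U \<Longrightarrow> y \<in> U \<Longrightarrow> x = y"
  shows "closedin X D"
proof -
  have "\<exists>T. openin X T \<and> x \<in> T \<and> T \<subseteq> topspace X - D" if x: "x \<in> topspace X - D" for x
  proof -
    obtain U where U: "U \<in> \<U>" "x \<in> U" "openin X U"
      using x assms(2) unfolding open_cover_def by blast
    have "D \<inter> U \<subseteq> {d}" if "d \<in> D \<inter> U" for d using that sep[OF U(1)] by blast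
    then have "finite (D \<inter> U)"
      by (metis finite.emptyI finite.insertI finite_subset equals0I)
    then have "closedin X (D \<inter> U)"
      using assms(1,3) unfolding t1_space_closedin_finite by blast
    then have "openin X (U - D \<inter> U)" using U(3) by blast
    then show ?thesis
      using U x openin_subset[OF U(3)] by (intro exI[of _ "U - D \<inter> U"]) blast
  qed
  then have "openin X (topspace X - D)" by (subst openin_subopen) blast
  then show ?thesis using assms(3) unfolding closedin_def by blast
qed

lemma normal_DCCC_countable_disjoint_neighbourhoods:
  assumes "normal_space X" "DCCC X" and D: "closedin X D"
    and W: "\<And>x. x \<in> D \<Longrightarrow> openin X (W x) \<and> x \<in> W x"
    and disj: "\<And>x y. x \<in> D \<Longrightarrow> y \<in> D \<Longrightarrow> x \<noteq> y \<Longrightarrow> W x \<inter> W y = {}"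
  shows "countable D"
proof -
  have "openin X (\<Union>x\<in>D. W x)" using W by blast
  moreover have "D \<subseteq> (\<Union>x\<in>D. W x)" using W by blast
  \<comment> \<open>Cutting every \<open>W x\<close> down to \<open>G\<close> gives discreteness: a
    point of the closure of \<open>G\<close> has some \<open>W x\<close> as a neighbourhood, which
    meets no other trace, and any other point has a neighbourhood missing \<open>G\<close>.\<close>
  ultimately obtain G where G: "openin X G" "D \<subseteq> G" "X closure_of G \<subseteq> (\<Union>x\<in>D. W x)"
    using assms(1)[unfolded normal_space_alt, rule_format, of D "\<Union>x\<in>D. W x"] D by blast
  define \<F> where "\<F> = (\<lambda>x. W x \<inter> G) ` D"
  have "discrete_family X \<F>"
    unfolding discrete_family_def
  proof
    fix p assume p: "p \<in> topspace X"
    show "\<exists>N. openin X N \<and> p \<in> N \<and>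
        (\<forall>F\<in>\<F>. \<forall>H\<in>\<F>. F \<inter> N \<noteq> {} \<longrightarrow> H \<inter> N \<noteq> {} \<longrightarrow> F = H)"
    proof (cases "p \<in> X closure_of G")
      case True
      then obtain x where x: "x \<in> D" "p \<in> W x" using G by blast
      have "y = x" if "y \<in> D" "W y \<inter> G \<inter> W x \<noteq> {}" for y
        using disj[OF that(1) x(1)] that(2) by blast
      then have "\<forall>F\<in>\<F>. F \<inter> W x \<noteq> {} \<longrightarrow> F = W x \<inter> G" unfolding \<F>_def by blast
      then show ?thesis using W[OF x(1)] x(2) by (intro exI[of _ "W x"]) blast
    next
      case False
      then obtain N where "openin X N" "p \<in> N" "N \<inter> G = {}"
        using p unfolding in_closure_of by blast
      then show ?thesis unfolding \<F>_def by (intro exI[of _ N]) blast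
    qed
  qed
  moreover have "\<forall>F\<in>\<F>. openin X F" using W G(1) unfolding \<F>_def by blast
  ultimately have "countable \<F>" using assms(2) unfolding DCCC_def by blast
  \<comment> \<open>The traces over distinct points are disjoint, and each contains its own point
    because \<open>D\<close> lies in \<open>G\<close>.\<close>
  moreover have "inj_on (\<lambda>x. W x \<inter> G) D"
  proof (rule inj_onI)
    fix x y assume "x \<in> D" "y \<in> D" "W x \<inter> G = W y \<inter> G"
    then show "x = y" using disj W G(2) by blast
  qed
  ultimately show ?thesis unfolding \<F>_def by (rule countable_image_inj_on)
qed

lemma normal_DCCC_imp_weakly_strongly_star_Lindelof:
  assumes "T1_normal_space X" "DCCC X"
  shows "weakly_strongly_star_Lindelof X"
  unfolding weakly_strongly_star_Lindelof_def
proof (intro allI impI)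
  fix \<U> assume \<U>: "open_cover X \<U>"
  define B where "B = {(x, W). openin X W \<and> x \<in> W \<and> (\<exists>U\<in>\<U>. W \<subseteq> U)}"
  \<comment> \<open>The two conditions serve different ends: disjoint neighbourhoods yield
    countability, and separation of the points by \<U> makes \<open>D\<close> closed.\<close>
  define R where "R = (\<lambda>(x::'a, W::'a set) (y, W'). W \<inter> W' = {} \<and> (\<forall>U\<in>\<U>. \<not> (x \<in> U \<and> y \<in> U)))"
  obtain P where P: "P \<subseteq> B" "pairwise R P"
    and max: "\<And>p. p \<in> B \<Longrightarrow> (\<And>q. q \<in> P \<Longrightarrow> R p q \<and> R q p) \<Longrightarrow> p \<in> P"
    using maximal_pairwise_subset[of B R] by blast
  define D where "D = fst ` P"
  have PD: "R (x, V) (y, W)" if "(x, V) \<in> P" "(y, W) \<in> P" "(x, V) \<noteq> (y, W)" for x y V W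
    using P(2) that unfolding pairwise_def by blast
  have "\<forall>x\<in>D. \<exists>V. (x, V) \<in> P" unfolding D_def by auto
  then obtain W where W: "\<And>x. x \<in> D \<Longrightarrow> (x, W x) \<in> P" by metis
  have WB: "openin X (W x) \<and> x \<in> W x \<and> (\<exists>U\<in>\<U>. W x \<subseteq> U)" if "x \<in> D" for x
    using W[OF that] P(1) unfolding B_def by blast
  have sub: "D \<subseteq> topspace X" using WB openin_subset by blast
  have "closedin X D"
  proof (rule closedin_if_cover_separates[OF _ \<U> sub])
    show "t1_space X" using assms(1) unfolding T1_normal_space_def by blast
    show "x = y" if "U \<in> \<U>" "x \<in> D" "y \<in> D" "x \<in> U" "y \<in> U" for U x y
      using PD[OF W[OF that(2)] W[OF that(3)]] that unfolding R_def by blast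
  qed
  have "countable D"
  proof (rule normal_DCCC_countable_disjoint_neighbourhoods[OF _ assms(2) \<open>closedin X D\<close>])
    show "normal_space X" using assms(1) unfolding T1_normal_space_def by blast
    show "W x \<inter> W y = {}" if "x \<in> D" "y \<in> D" "x \<noteq> y" for x y
      using PD[OF W[OF that(1)] W[OF that(2)]] that unfolding R_def by blast
  qed (use WB in blast)
  moreover have "X closure_of (st D \<U>) = topspace X"
  proof (rule dense_if_meets_open)
    fix Q x assume Q: "openin X Q" "x \<in> Q" "Q \<inter> st D \<U> = {}"
    then obtain U where U: "U \<in> \<U>" "x \<in> U" "openin X U"
      using \<U> openin_subset unfolding open_cover_def by blast
    \<comment> \<open>This pair is compatible with all of \<open>P\<close>: a chosen neighbourhood
      lies in a cover member around its point, hence in the star, and so misses \<open>Q\<close>; a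
      cover member containing \<open>x\<close> and a point of \<open>D\<close> would put
      \<open>x\<close> into the star. By maximality \<open>x\<close> is in \<open>D\<close>, yet
      \<open>U\<close> then puts it into the star.\<close>
    have "(x, Q \<inter> U) \<in> B" using Q U unfolding B_def by blast
    moreover have far: "V \<inter> Q = {}" "T \<in> \<U> \<Longrightarrow> \<not> (x \<in> T \<and> y \<in> T)" "y \<in> D"
      if "(y, V) \<in> P" for y V T
    proof -
      show y: "y \<in> D" using that unfolding D_def by force
      have "\<exists>U\<in>\<U>. V \<subseteq> U" "y \<in> V" using that P(1) unfolding B_def by blast+
      then have "V \<subseteq> st D \<U>" using y unfolding st_def by blast
      then show "V \<inter> Q = {}" using Q(3) by blast
      show "\<not> (x \<in> T \<and> y \<in> T)" if "T \<in> \<U>"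
        using that y Q(2,3) unfolding st_def by blast
    qed
    ultimately have "(x, Q \<inter> U) \<in> P"
      using max[of "(x, Q \<inter> U)"] unfolding R_def by fastforce
    then show False using far(2)[of x _ U] U by blast
  qed
  ultimately show "\<exists>A\<subseteq>topspace X. countable A \<and> X closure_of (st A \<U>) = topspace X"
    using sub by blast
qed

section \<open>Regular spaces: from star properties back to the DCCC\<close>

text \<open>
  A member of the cover below lies inside \<open>(g ^^ j) F\<close> or misses \<open>(g ^^ Suc j) F\<close> for each \<open>j < k\<close>,
  so that each star penetrates \<open>F\<close> by at most one level.
\<close>

lemma regular_discrete_family_far_cover:
  assumes reg: "regular_space X" and disc: "discrete_family X \<F>"
    and \<F>: "\<And>F. F \<in> \<F> \<Longrightarrow> openin X F \<and> F \<noteq> {}"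
  obtains \<U> where "open_cover X \<U>"
    "\<And>U F G. U \<in> \<U> \<Longrightarrow> F \<in> \<F> \<Longrightarrow> G \<in> \<F> \<Longrightarrow> F \<inter> U \<noteq> {} \<Longrightarrow> G \<inter> U \<noteq> {} \<Longrightarrow> F = G"
    "\<And>S F. F \<in> \<F> \<Longrightarrow> S \<inter> F = {} \<Longrightarrow> st_iter k S \<U> \<noteq> topspace X"
proof -
  have "\<exists>V. openin X V \<and> V \<noteq> {} \<and> X closure_of V \<subseteq> F" if F: "openin X F" "F \<noteq> {}" for F
  proof -
    obtain x where "x \<in> F" using F by blast
    then obtain V C where "openin X V" "closedin X C" "x \<in> V" "V \<subseteq> C" "C \<subseteq> F"
      using reg F unfolding neighbourhood_base_of_closedin[symmetric] neighbourhood_base_of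
      by metis
    moreover from this have "X closure_of V \<subseteq> F" using closure_of_minimal[of V C X] by blast
    ultimately show ?thesis by blast
  qed
  \<comment> \<open>Iterating \<open>g\<close> gives the levels of \<open>F\<close>: nonempty open
    sets, each containing the closure of the next.\<close>
  then obtain g where g: "\<And>F. openin X F \<Longrightarrow> F \<noteq> {} \<Longrightarrow>
      openin X (g F) \<and> g F \<noteq> {} \<and> X closure_of g F \<subseteq> F"
    by metis
  have gj: "openin X ((g ^^ j) F) \<and> (g ^^ j) F \<noteq> {}" if "F \<in> \<F>" for F j
    by (induction j) (use \<F>[OF that] g in auto)
  have cl: "X closure_of (g ^^ Suc j) F \<subseteq> (g ^^ j) F" if "F \<in> \<F>" for F j
    using g gj[OF that] by simp
  have gF: "(g ^^ j) F \<subseteq> F" if "F \<in> \<F>" for F j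
  proof (induction j)
    case (Suc j)
    have "(g ^^ Suc j) F \<subseteq> (g ^^ j) F"
      using cl[OF that, of j] gj[OF that, of "Suc j"]
        closure_of_subset[OF openin_subset, of X "(g ^^ Suc j) F"] by (meson order_trans)
    with Suc show ?case by blast
  qed simp
  define \<U> where "\<U> = {U. openin X U \<and>
      (\<forall>F\<in>\<F>. \<forall>G\<in>\<F>. F \<inter> U \<noteq> {} \<longrightarrow> G \<inter> U \<noteq> {} \<longrightarrow> F = G) \<and>
      (\<forall>F\<in>\<F>. \<forall>j<k. U \<subseteq> (g ^^ j) F \<or> U \<inter> (g ^^ Suc j) F = {})}"
  show thesis
  proof (rule that)
    have "\<exists>U\<in>\<U>. x \<in> U" if x: "x \<in> topspace X" for x
    proof -
      obtain N where N: "openin X N" "x \<in> N"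
        "\<And>F G. F \<in> \<F> \<Longrightarrow> G \<in> \<F> \<Longrightarrow> F \<inter> N \<noteq> {} \<Longrightarrow> G \<inter> N \<noteq> {} \<Longrightarrow> F = G"
        using disc x unfolding discrete_family_def by metis
      show ?thesis
      proof (cases "\<exists>F\<in>\<F>. F \<inter> N \<noteq> {}")
        case False
        then have "N \<inter> (g ^^ j) F = {}" if "F \<in> \<F>" for F j
          using that gF[OF that, of j] by blast
        then have "\<forall>F\<in>\<F>. \<forall>j<k. N \<subseteq> (g ^^ j) F \<or> N \<inter> (g ^^ Suc j) F = {}" by blast
        moreover have "\<forall>F\<in>\<F>. \<forall>G\<in>\<F>. F \<inter> N \<noteq> {} \<longrightarrow> G \<inter> N \<noteq> {} \<longrightarrow> F = G"
          using N(3) by blast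
        ultimately have "N \<in> \<U>" using N(1) unfolding \<U>_def by blast
        then show ?thesis using N by blast
      next
        case True
        then obtain F where F: "F \<in> \<F>" "F \<inter> N \<noteq> {}" by blast
        \<comment> \<open>Both alternatives are open and contain \<open>x\<close>: if
          \<open>x\<close> is outside level \<open>j\<close>, it is also outside the closure of
          level \<open>Suc j\<close>.\<close>
        define T where "T j = (if x \<in> (g ^^ j) F then (g ^^ j) F
          else topspace X - X closure_of (g ^^ Suc j) F)" for j
        \<comment> \<open>For \<open>k = 0\<close> the intersection over \<open>j < k\<close> is
          \<open>UNIV\<close>; the factor \<open>topspace X\<close> keeps it open in
          \<open>X\<close>.\<close>
        define U where "U = N \<inter> (topspace X \<inter> \<Inter>(T ` {..<k}))"
        have T: "openin X (T j)" "x \<in> T j" for j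
          using gj[OF F(1)] cl[OF F(1)] x unfolding T_def by auto
        have sep: "U \<subseteq> (g ^^ j) F \<or> U \<inter> (g ^^ Suc j) F = {}" if "j < k" for j
        proof (cases "x \<in> (g ^^ j) F")
          case True
          then show ?thesis using that unfolding U_def T_def by auto
        next
          case False
          then have "U \<subseteq> topspace X - X closure_of (g ^^ Suc j) F"
            using that unfolding U_def T_def by auto
          moreover have "(g ^^ Suc j) F \<subseteq> X closure_of (g ^^ Suc j) F"
            using gj[OF F(1), of "Suc j"] by (intro closure_of_subset openin_subset) blast
          ultimately show ?thesis by blast
        qed
        \<comment> \<open>\<open>N\<close> already meets \<open>F\<close>, so it misses every other
          member of \<F> and all of its levels.\<close>
        have other: "U \<inter> (g ^^ j) G = {}" if "G \<in> \<F>" "G \<noteq> F" for G j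
          using N(3)[OF that(1) F(1)] that(2) F(2) gF[OF that(1), of j] unfolding U_def by blast
        have "openin X (topspace X \<inter> \<Inter>(T ` {..<k}))"
          using T by (cases k) (auto intro!: openin_Int openin_Inter)
        then have "openin X U" using N(1) unfolding U_def by blast
        moreover have "\<forall>F\<in>\<F>. \<forall>G\<in>\<F>. F \<inter> U \<noteq> {} \<longrightarrow> G \<inter> U \<noteq> {} \<longrightarrow> F = G"
          using N(3) unfolding U_def by blast
        moreover have "\<forall>G\<in>\<F>. \<forall>j<k. U \<subseteq> (g ^^ j) G \<or> U \<inter> (g ^^ Suc j) G = {}"
          using sep other by metis
        ultimately have "U \<in> \<U>" unfolding \<U>_def by blast
        moreover have "x \<in> U" using N(2) T(2) x unfolding U_def by simp
        ultimately show ?thesis by blast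
      qed
    qed
    moreover have "\<forall>U\<in>\<U>. openin X U" unfolding \<U>_def by blast
    ultimately show "open_cover X \<U>"
      unfolding open_cover_def by (auto dest: openin_subset)
    show "F = G" if "U \<in> \<U>" "F \<in> \<F>" "G \<in> \<F>" "F \<inter> U \<noteq> {}" "G \<inter> U \<noteq> {}" for U F G
      using that unfolding \<U>_def by blast
    show "st_iter k S \<U> \<noteq> topspace X" if "F \<in> \<F>" "S \<inter> F = {}" for S F
    proof -
      \<comment> \<open>A cover member meeting the \<open>j\<close>-th star is not contained in
        level \<open>j\<close>, which that star misses, so it misses level \<open>Suc j\<close>. At
        \<open>j = k\<close> a nonempty level stays unreached.\<close>
      have "j \<le> k \<Longrightarrow> st_iter j S \<U> \<inter> (g ^^ j) F = {}" for j
      proof (induction j)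
        case (Suc j)
        have "U \<inter> (g ^^ Suc j) F = {}" if U: "U \<in> \<U>" "U \<inter> st_iter j S \<U> \<noteq> {}" for U
        proof -
          have "\<not> U \<subseteq> (g ^^ j) F" using U(2) Suc by auto
          moreover have "j < k" using Suc.prems by simp
          ultimately show ?thesis using U(1) \<open>F \<in> \<F>\<close> unfolding \<U>_def by blast
        qed
        then show ?case unfolding st_iter.simps st_def by blast
      qed (use that in simp)
      then show ?thesis using gj[OF that(1), of k] openin_subset[of X "(g ^^ k) F"] by blast
    qed
  qed
qed

text \<open>Otherwise, choosing for each \<open>F\<close> a member of \<W> that meets it would
  inject \<F> into \<W>.\<close>

lemma uncountable_family_misses:
  assumes "uncountable \<F>" "countable \<W>"
    and one: "\<And>W F G. W \<in> \<W> \<Longrightarrow> F \<in> \<F> \<Longrightarrow> G \<in> \<F> \<Longrightarrow> F \<inter> W \<noteq> {} \<Longrightarrow> G \<inter> W \<noteq> {} \<Longrightarrow> F = G"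
  obtains F where "F \<in> \<F>" "\<Union>\<W> \<inter> F = {}"
proof (rule ccontr)
  assume "\<not> thesis"
  then have "\<forall>F\<in>\<F>. \<exists>W\<in>\<W>. F \<inter> W \<noteq> {}" using that by blast
  then obtain w where w: "\<And>F. F \<in> \<F> \<Longrightarrow> w F \<in> \<W> \<and> F \<inter> w F \<noteq> {}" by metis
  then have "inj_on w \<F>" using one by (metis inj_onI)
  moreover have "countable (w ` \<F>)"
    using w assms(2) by (meson countable_subset image_subsetI)
  ultimately show False using assms(1) countable_image_inj_on by blast
qed

text \<open>Discarding the empty member keeps the family uncountable, and only nonempty sets can be
  shrunk to nonempty levels.\<close>

lemma not_DCCC_nonempty_family:
  assumes "\<not> DCCC X"
  obtains \<F> where "\<And>F. F \<in> \<F> \<Longrightarrow> openin X F \<and> F \<noteq> {}" "discrete_family X \<F>" "uncountable \<F>"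
proof -
  obtain \<F> where \<F>: "\<forall>U\<in>\<F>. openin X U" "discrete_family X \<F>" "uncountable \<F>"
    using assms unfolding DCCC_def by blast
  have "discrete_family X (\<F> - {{}})"
    using \<F>(2) unfolding discrete_family_def by (meson DiffD1)
  moreover have "uncountable (\<F> - {{}})" using \<F>(3) by (simp add: uncountable_minus_countable)
  ultimately show thesis using \<F>(1) by (intro that[of "\<F> - {{}}"]) auto
qed

text \<open>Each member of the far cover meets at most one \<open>F\<close>, so countably many of
  them miss some \<open>F\<close> entirely, and \<open>k\<close> stars do not fill the
  space.\<close>

lemma regular_star_Lindelof_imp_DCCC:
  assumes "regular_space X" "star_Lindelof k X"
  shows "DCCC X"
proof (rule ccontr)
  assume "\<not> DCCC X"
  then obtain \<F> where \<F>: "\<And>F. F \<in> \<F> \<Longrightarrow> openin X F \<and> F \<noteq> {}"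
    "discrete_family X \<F>" "uncountable \<F>"
    by (rule not_DCCC_nonempty_family) blast
  obtain \<U> where \<U>: "open_cover X \<U>"
    "\<And>U F G. U \<in> \<U> \<Longrightarrow> F \<in> \<F> \<Longrightarrow> G \<in> \<F> \<Longrightarrow> F \<inter> U \<noteq> {} \<Longrightarrow> G \<inter> U \<noteq> {} \<Longrightarrow> F = G"
    "\<And>S F. F \<in> \<F> \<Longrightarrow> S \<inter> F = {} \<Longrightarrow> st_iter k S \<U> \<noteq> topspace X"
    using regular_discrete_family_far_cover[OF assms(1) \<F>(2,1)] by metis
  obtain \<V> where \<V>: "\<V> \<subseteq> \<U>" "countable \<V>" "st_iter k (\<Union>\<V>) \<U> = topspace X"
    using assms(2) \<U>(1) unfolding star_Lindelof_def by blast
  obtain F where "F \<in> \<F>" "\<Union>\<V> \<inter> F = {}"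
    by (rule uncountable_family_misses[OF \<F>(3) \<V>(2)]) (use \<U>(2) \<V>(1) in blast)+
  then show False using \<U>(3)[of F "\<Union>\<V>"] \<V>(3) by simp
qed

text \<open>An open set disjoint from \<F> misses the closure of \<open>\<Union>\<F>\<close>; if it
  also misses the complement of that closure, it is empty.\<close>

lemma maximal_disjoint_open_family_extension:
  assumes "disjoint_open_family X \<F>"
  shows "maximal_disjoint_open_family X
    (insert {} (insert (topspace X - X closure_of \<Union>\<F>) \<F>))"
    (is "maximal_disjoint_open_family X ?\<A>")
  unfolding maximal_disjoint_open_family_def
proof (intro conjI allI impI)
  have \<F>: "\<And>F. F \<in> \<F> \<Longrightarrow> openin X F" "pairwise disjnt \<F>"
    using assms unfolding disjoint_open_family_def by auto
  then have "\<Union>\<F> \<subseteq> X closure_of \<Union>\<F>" by (meson closure_of_subset openin_Union openin_subset)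
  then have "disjnt (topspace X - X closure_of \<Union>\<F>) F" if "F \<in> \<F>" for F
    using that unfolding disjnt_def by blast
  then show "disjoint_open_family X ?\<A>"
    using \<F> unfolding disjoint_open_family_def
    by (auto simp: pairwise_insert disjnt_sym openin_diff)
  fix \<B> assume \<B>: "disjoint_open_family X \<B>" "?\<A> \<subseteq> \<B>"
  have "B \<in> ?\<A>" if B: "B \<in> \<B>" for B
  proof (rule ccontr)
    assume notin: "B \<notin> ?\<A>"
    then have disj: "A \<inter> B = {}" if "A \<in> ?\<A>" for A
    proof -
      have "A \<in> \<B>" "A \<noteq> B" using that notin \<B>(2) by auto
      then show ?thesis
        using B \<B>(1) unfolding disjoint_open_family_def pairwise_def disjnt_def by blast
    qed
    have "openin X B" using B \<B>(1) unfolding disjoint_open_family_def by blast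
    moreover have "\<Union>\<F> \<inter> B = {}" using disj by blast
    ultimately have "X closure_of \<Union>\<F> \<inter> B = {}"
      by (metis Int_commute openin_Int_closure_of_eq_empty)
    moreover have "(topspace X - X closure_of \<Union>\<F>) \<inter> B = {}" using disj by blast
    moreover have "B \<subseteq> topspace X" using \<open>openin X B\<close> openin_subset by blast
    ultimately have "B = {}" by blast
    then show False using notin by blast
  qed
  then show "\<B> = ?\<A>" using \<B>(2) by blast
qed

lemma regular_selectively_star_ccc_imp_DCCC:
  assumes "regular_space X" "selectively_star_ccc k X"
  shows "DCCC X"
proof (rule ccontr)
  assume "\<not> DCCC X"
  then obtain \<F> where \<F>: "\<And>F. F \<in> \<F> \<Longrightarrow> openin X F \<and> F \<noteq> {}"
    "discrete_family X \<F>" "uncountable \<F>"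
    by (rule not_DCCC_nonempty_family) blast
  obtain \<U> where \<U>: "open_cover X \<U>"
    "\<And>S F. F \<in> \<F> \<Longrightarrow> S \<inter> F = {} \<Longrightarrow> st_iter k S \<U> \<noteq> topspace X"
    using regular_discrete_family_far_cover[OF assms(1) \<F>(2,1)] by metis
  have disj: "F = G" if FG: "F \<in> \<F>" "G \<in> \<F>" "F \<inter> G \<noteq> {}" for F G
  proof -
    obtain x where "x \<in> F" "x \<in> G" using FG by blast
    moreover have "x \<in> topspace X"
      using \<open>x \<in> F\<close> \<F>(1)[OF FG(1)] openin_subset by blast
    ultimately show ?thesis using \<F>(2) FG unfolding discrete_family_def by blast
  qed
  then have "disjoint_open_family X \<F>"
    using \<F>(1) unfolding disjoint_open_family_def pairwise_def disjnt_def by blast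
  define \<A> where "\<A> = insert {} (insert (topspace X - X closure_of \<Union>\<F>) \<F>)"
  have "maximal_disjoint_open_family X \<A>"
    unfolding \<A>_def
    by (rule maximal_disjoint_open_family_extension[OF \<open>disjoint_open_family X \<F>\<close>])
  \<comment> \<open>The same maximal family is used at every index, so a selection picks only
    countably many members of \<F>.\<close>
  then have "\<exists>A. (\<forall>n::nat. A n \<in> \<A>) \<and> st_iter k (\<Union>n. A n) \<U> = topspace X"
    using assms(2)[unfolded selectively_star_ccc_def, rule_format, OF \<U>(1), of "\<lambda>_. \<A>"] by simp
  then obtain A :: "nat \<Rightarrow> 'a set" where A: "\<And>n. A n \<in> \<A>" "st_iter k (\<Union>n. A n) \<U> = topspace X"
    by blast
  have one: "F = G" if "V \<in> range A" "F \<in> \<F>" "G \<in> \<F>" "F \<inter> V \<noteq> {}" "G \<inter> V \<noteq> {}" for V F G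
  proof -
    have "\<Union>\<F> \<subseteq> X closure_of \<Union>\<F>"
      using \<F>(1) by (meson closure_of_subset openin_Union openin_subset)
    \<comment> \<open>The two sets added to \<F> meet no member of \<F>, so a selected set that
      meets one must belong to \<F>.\<close>
    then have "V \<in> \<F>" using that A(1) unfolding \<A>_def by blast
    then show ?thesis using disj that by blast
  qed
  obtain F where "F \<in> \<F>" "\<Union>(range A) \<inter> F = {}"
    by (rule uncountable_family_misses[OF \<F>(3), of "range A"]) (use one in blast)+
  then show False using \<U>(2) A(2) by blast
qed

section \<open>Assembling the equivalences\<close>

lemma equivalent_on_insert_in_between:
  assumes "equivalent_on C \<P>" "in_between C \<P> R"
  shows "equivalent_on C (insert R \<P>)"
  unfolding equivalent_on_def
proof (intro ballI)
  have trans: "implies_on C P Q \<Longrightarrow> implies_on C Q S \<Longrightarrow> implies_on C P S" for P Q S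
    unfolding implies_on_def by simp
  have eq: "implies_on C P Q" if "P \<in> \<P>" "Q \<in> \<P>" for P Q
    using assms(1) that unfolding equivalent_on_def by simp
  obtain P Q where PQ: "P \<in> \<P>" "Q \<in> \<P>" "implies_on C P R" "implies_on C R Q"
    using assms(2) unfolding in_between_def by auto
  fix S T assume "S \<in> insert R \<P>" "T \<in> insert R \<P>"
  \<comment> \<open>\<open>P\<close> serves as a hub: if \<open>S\<close> is \<open>R\<close>, it is
    reached through \<open>Q\<close>; if \<open>T\<close> is \<open>R\<close>, it follows from
    \<open>P\<close> directly.\<close>
  then have "implies_on C S P" "implies_on C P T"
    using PQ eq trans[OF PQ(4) eq[OF PQ(2,1)]] by auto
  then show "implies_on C S T" by (rule trans)
qed

lemma T1_normal_imp_regular_space: "T1_normal_space X \<Longrightarrow> regular_space X"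
  unfolding T1_normal_space_def by (simp add: normal_t1_imp_regular_space)

lemma regular_equivalences:
  "equivalent_on regular_space
     {DCCC, weakly_star_Lindelof, star_Lindelof 2, selectively_star_ccc 3}"
proof -
  have "P X \<longleftrightarrow> DCCC X" if "regular_space X"
    "P \<in> {DCCC, weakly_star_Lindelof, star_Lindelof 2, selectively_star_ccc 3}"
    for X :: "'a topology" and P
    using that DCCC_imp_weakly_star_Lindelof weakly_star_Lindelof_imp_star_Lindelof_2
      weakly_star_Lindelof_imp_selectively_star_ccc_3 regular_star_Lindelof_imp_DCCC
      regular_selectively_star_ccc_imp_DCCC by blast
  then show ?thesis unfolding equivalent_on_def implies_on_def by blast
qed

lemma normal_equivalences:
  "equivalent_on T1_normal_space
     {DCCC, weakly_strongly_star_Lindelof, strongly_star_Lindelof 2, selectively_star_ccc 3}"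
proof -
  have "P X \<longleftrightarrow> DCCC X" if X: "T1_normal_space X"
    and P: "P \<in> {DCCC, weakly_strongly_star_Lindelof, strongly_star_Lindelof 2, selectively_star_ccc 3}"
    for X :: "'a topology" and P
  proof -
    have reg: "regular_space X" using X by (rule T1_normal_imp_regular_space)
    \<comment> \<open>The way back passes through 2-SL, where regularity suffices. Towards
      selectively 3-star-ccc the argument goes through weakly SL.\<close>
    have "strongly_star_Lindelof 2 X \<Longrightarrow> DCCC X"
      using strongly_star_Lindelof_imp_star_Lindelof[of 1 X] regular_star_Lindelof_imp_DCCC[OF reg]
      by (simp add: numeral_2_eq_2)
    then show ?thesis
      using P DCCC_imp_weakly_star_Lindelof weakly_star_Lindelof_imp_selectively_star_ccc_3
        regular_selectively_star_ccc_imp_DCCC[OF reg]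
        normal_DCCC_imp_weakly_strongly_star_Lindelof[OF X]
        weakly_strongly_star_Lindelof_imp_strongly_star_Lindelof_2 by blast
  qed
  then show ?thesis unfolding equivalent_on_def implies_on_def by blast
qed

theorem corollary2p6:
  "(\<forall>(X :: 'a topology) k. regular_space X \<and> k \<ge> 1 \<and> selectively_star_ccc k X \<longrightarrow> DCCC X) \<and>
   (let \<P> = {DCCC, weakly_star_Lindelof, star_Lindelof 2, selectively_star_ccc 3
               :: 'a topology \<Rightarrow> bool}
    in equivalent_on regular_space \<P> \<and>
       (\<forall>R. in_between regular_space \<P> R \<longrightarrow> equivalent_on regular_space (insert R \<P>))) \<and>
   (let \<P> = {DCCC, weakly_strongly_star_Lindelof, strongly_star_Lindelof 2, selectively_star_ccc 3
               :: 'a topology \<Rightarrow> bool}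
    in equivalent_on T1_normal_space \<P> \<and>
       (\<forall>R. in_between T1_normal_space \<P> R \<longrightarrow> equivalent_on T1_normal_space (insert R \<P>)))"
  unfolding Let_def
  using regular_selectively_star_ccc_imp_DCCC regular_equivalences normal_equivalences
    equivalent_on_insert_in_between[OF regular_equivalences]
    equivalent_on_insert_in_between[OF normal_equivalences]
  by blast

end
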